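(* Define integers $a_{r,j}$ and $b_{r,j}$ for $r\geqslant 1$, $j\geqslant 0$ by the initial conditions $$a_{1,j}=b_{1,j}=\begin{cases}1,& j=0,\\ 0,& j>0,\end{cases}$$ and, for all $r\geqslant 1$ and $j\geqslant 0$, the recurrence relations $$a_{r+1,j} = a_{r,j+1} - \mu(r)\, b_{r,j+1}-\begin{cases}0,& j+1<r,\\ a_{r,j+1-r},& j+1\geqslant r,\end{cases}$$ $$b_{r+1,j} = b_{r,j}-\begin{cases}0,& j<r,\\ b_{r,j-r},& j\geqslant r.\end{cases}$$ Then for all integers $n\geqslant 0$ and $r\geqslant 1$, $$\sum_{k=r}^{n+r} S^{(r)}_{n+r,k}\, \mu(k) = \sum_{j\geqslant 0} a_{r,j}\, p(n-j).$$
   Context: $p(m)$ denotes the number of partitions of the integer $m$, with $p(0)=1$ and $p(m)=0$ for $m<0$ (so the sum over $j$ is finite). $\mu$ is the classical Möbius function on positive integers: $\mu(m)=0$ if $m$ is divisible by the square of a prime, and $\mu(m)=(-1)^s$ if $m$ is a product of $s\geqslant 0$ distinct primes. For integers $r\geqslant 1$, $k\geqslant 1$, $m\geqslant 0$, $S^{(r)}_{m,k}$ denotes the number of $k$'s in the partitions of $m$ with smallest part at least $r$, i.e. the total number of occurrences (with multiplicity) of the part $k$ summed over all partitions of $m$ all of whose parts are $\geqslant r$. *)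

theory Defs
  imports Main "HOL-Library.Multiset" "HOL-Library.Groups_Big_Fun"
    "HOL-Computational_Algebra.Primes"
begin

text \<open>A partition is the multiset of its parts.\<close>

definition partitions :: "nat \<Rightarrow> nat multiset set" where
  "partitions m = {P. (\<forall>x\<in>#P. x \<ge> 1) \<and> sum_mset P = m}"

definition num_partitions :: "int \<Rightarrow> nat" where
  "num_partitions m = (if m < 0 then 0 else card (partitions (nat m)))"

definition moebius :: "nat \<Rightarrow> int" where
  "moebius m = (if \<exists>q. prime q \<and> q ^ 2 dvd m then 0 else (- 1) ^ card (prime_factors m))"

text \<open>\<open>num_occurrences r m k\<close> is $S^{(r)}_{m,k}$.\<close>

definition num_occurrences :: "nat \<Rightarrow> nat \<Rightarrow> nat \<Rightarrow> nat" where
  "num_occurrences r m k = (\<Sum>P\<in>{P \<in> partitions m. \<forall>x\<in>#P. x \<ge> r}. count P k)"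

text \<open>Finiteness, so that neither \<open>card\<close> nor the sum above takes its default value.\<close>

lemma finite_partitions: "finite (partitions m)"
proof -
  have "partitions m \<subseteq> mset ` {xs. set xs \<subseteq> {..m} \<and> length xs \<le> m}"
  proof
    fix P assume P: "P \<in> partitions m"
    obtain xs where xs: "P = mset xs" by (metis ex_mset)
    have pos: "\<forall>x\<in>set xs. x \<ge> 1" and s: "sum_list xs = m"
      using P xs by (auto simp: partitions_def sum_mset_sum_list)
    have "length xs \<le> sum_list xs"
      using pos by (induction xs) auto
    moreover have "set xs \<subseteq> {..m}"
      using s member_le_sum_list by auto
    ultimately show "P \<in> mset ` {xs. set xs \<subseteq> {..m} \<and> length xs \<le> m}"
      using xs s by auto
  qed
  thus ?thesis
    by (rule finite_subset) (intro finite_imageI finite_lists_length_le finite_atMost)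
qed

end

theory Submission
  imports Defs "HOL-Computational_Algebra.Formal_Power_Series"
begin

text \<open>
  Let \<open>F r\<close> be the generating function of the left-hand sides, \<open>N r\<close> that of the partitions into
  parts \<open>\<ge> r\<close>, and \<open>A r\<close>, \<open>B r\<close> those of the coefficient sequences. Splitting the partitions into
  parts \<open>\<ge> r\<close> by whether \<open>r\<close> occurs, and deleting one \<open>r\<close> if it does, gives
  \<open>N (r+1) = (1 - X^r) N r\<close> and \<open>F (r+1) = (1 - X^r) F r - \<mu>(r) X^r N r\<close>. The two recurrences of
  the theorem say the same of \<open>B r\<close> and \<open>X^r A r\<close>, except that the constant coefficient
  \<open>a r 0 = \<mu>(r) b r 0\<close> has to be read off from the identity for \<open>r\<close>. Hence \<open>N r = B r N 1\<close>
  and \<open>F r = X^r A r N 1\<close> follow by induction on \<open>r\<close>; the case \<open>r = 1\<close> amounts to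
  \<open>\<Sum>\<^sub>k \<mu>(k) X^k / (1 - X^k) = X\<close>, that is, to the vanishing of the divisor sums of \<open>\<mu>\<close>.
\<close>

unbundle fps_syntax

section \<open>The Moebius function and its divisor sums\<close>

lemma moebius_1 [simp]: "moebius (Suc 0) = 1"
proof -
  have "\<not> (\<exists>q::nat. prime q \<and> q ^ 2 dvd 1)"
    by (auto simp: power2_eq_square)
  then show ?thesis by (simp add: moebius_def)
qed

text \<open>The square of \<open>p\<close> divides neither \<open>k\<close> nor
  \<open>p * k\<close>, and the square of any other prime is coprime to \<open>p\<close>, so
  squarefreeness is unaffected. The prime factors gain exactly \<open>p\<close>, which flips the
  sign.\<close>

lemma moebius_prime_mult:
  fixes p k :: nat
  assumes p: "prime p" and k: "k > 0" and ndvd: "\<not> p dvd k"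
  shows "moebius (p * k) = - moebius k"
proof -
  have cop: "coprime p k" using p ndvd by (simp add: prime_imp_coprime)
  have sq: "q\<^sup>2 dvd p * k \<longleftrightarrow> q\<^sup>2 dvd k" if q: "prime q" for q :: nat
  proof (cases "q = p")
    case True
    have "\<not> p * p dvd p * k" using ndvd p by (simp add: prime_gt_0_nat)
    moreover have "\<not> p * p dvd k" using ndvd by (meson dvd_mult_left)
    ultimately show ?thesis by (simp add: True power2_eq_square)
  next
    case False
    then have "coprime (q\<^sup>2) p" using p q by (simp add: primes_coprime)
    then show ?thesis by (simp add: coprime_dvd_mult_right_iff)
  qed
  have "prime_factors (p * k) = insert p (prime_factors k)"
    using p k by (simp add: prime_factors_product prime_prime_factors prime_gt_0_nat)
  moreover have "p \<notin> prime_factors k" using ndvd by auto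
  ultimately show ?thesis
    using sq unfolding moebius_def by (auto simp: card_insert_if)
qed

text \<open>For a prime \<open>p\<close> dividing \<open>d\<close>, multiplication by
  \<open>p\<close> matches the divisors prime to \<open>p\<close> with those divisible by
  \<open>p\<close> exactly once and reverses the sign of \<open>moebius\<close>; all other divisors
  contribute 0.\<close>

lemma sum_moebius_divisors:
  fixes d :: nat
  assumes "d > 0"
  shows "(\<Sum>k | k dvd d. moebius k) = (if d = 1 then 1 else 0)"
proof (cases "d = 1")
  case True
  then show ?thesis by simp
next
  case False
  then obtain p where p: "prime p" "p dvd d" using prime_factor_nat by blast
  have p0: "p > 0" using p(1) by (rule prime_gt_0_nat)
  let ?U = "{k. k dvd d \<and> \<not> p dvd k}" and ?V = "{k. k dvd d \<and> p dvd k \<and> \<not> p\<^sup>2 dvd k}"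
    and ?W = "{k. k dvd d \<and> p\<^sup>2 dvd k}"
  have fin: "finite ?U" "finite ?V" "finite ?W" using assms by auto
  have p2: "p dvd k" if "p\<^sup>2 dvd k" for k
    using that by (auto simp: power2_eq_square dest: dvd_mult_left)
  have eq: "{k. k dvd d} = ?U \<union> (?V \<union> ?W)" by auto
  have W: "sum moebius ?W = 0"
    using p(1) by (intro sum.neutral) (auto simp: moebius_def)
  have "sum moebius ?V = (\<Sum>k\<in>?U. - moebius k)"
  proof (rule sum.reindex_bij_witness[where i = "\<lambda>k. p * k" and j = "\<lambda>k. k div p"])
    fix k assume k: "k \<in> ?V"
    then obtain l where l: "k = p * l" by auto
    show "p * (k div p) = k" using l p0 by simp
    show "k div p \<in> ?U"
      using k l p0 by (auto simp: power2_eq_square intro: dvd_mult_right)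
    then show "- moebius (k div p) = moebius k"
      using moebius_prime_mult[OF p(1), of "k div p"] l p0 assms by (auto intro: Nat.gr0I)
  next
    fix k assume k: "k \<in> ?U"
    show "p * k div p = k" using p0 by simp
    have "coprime p k" using p(1) k by (simp add: prime_imp_coprime)
    then show "p * k \<in> ?V"
      using k p p0 by (auto simp: power2_eq_square intro: divides_mult)
  qed
  then show ?thesis
    using False W fin unfolding eq
    by (subst sum.union_disjoint; (subst sum.union_disjoint)?) (auto simp: sum_negf dest: p2)
qed

section \<open>Partitions with a lower bound on the parts\<close>

definition partitions_ge :: "nat \<Rightarrow> nat \<Rightarrow> nat multiset set" where
  "partitions_ge r m = {P \<in> partitions m. \<forall>x\<in>#P. x \<ge> r}"

lemma finite_partitions_ge [simp]: "finite (partitions_ge r m)"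
  by (simp add: partitions_ge_def finite_partitions)

lemma partitions_ge_1 [simp]: "partitions_ge (Suc 0) m = partitions m"
  by (auto simp: partitions_ge_def partitions_def)

lemma partitions_0 [simp]: "partitions 0 = {{#}}"
proof -
  have "P = {#}" if "P \<in> partitions 0" for P
    using that by (cases P) (auto simp: partitions_def)
  then show ?thesis by (auto simp: partitions_def)
qed

lemma partitions_ge_0 [simp]: "partitions_ge r 0 = {{#}}"
  by (auto simp: partitions_ge_def)

lemma set_mset_partitions_ge:
  "P \<in> partitions_ge r m \<Longrightarrow> set_mset P \<subseteq> {r..m}"
  by (auto simp: partitions_ge_def partitions_def dest!: multi_member_split)

lemma partitions_ge_empty:
  assumes "0 < m" "m < r"
  shows "partitions_ge r m = {}"
proof -
  have "P \<notin> partitions_ge r m" for P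
  proof
    assume P: "P \<in> partitions_ge r m"
    then have "P = {#}" using set_mset_partitions_ge[OF P] assms(2) by auto
    with P assms(1) show False by (auto simp: partitions_ge_def partitions_def)
  qed
  then show ?thesis by blast
qed

lemma partitions_ge_Suc: "partitions_ge (Suc r) m = {P \<in> partitions_ge r m. r \<notin># P}"
  by (auto simp: partitions_ge_def Suc_le_eq order_less_le)

lemma partitions_ge_containing:
  assumes "1 \<le> k" "r \<le> k"
  shows "{P \<in> partitions_ge r m. k \<in># P}
    = (if k \<le> m then add_mset k ` partitions_ge r (m - k) else {})"
proof (cases "k \<le> m")
  case True
  have "P \<in> add_mset k ` partitions_ge r (m - k)" if P: "P \<in> partitions_ge r m" "k \<in># P" for P
  proof -
    obtain Q where "P = add_mset k Q" using P(2) by (auto dest: multi_member_split)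
    then show ?thesis using P(1) by (auto simp: partitions_ge_def partitions_def)
  qed
  then show ?thesis
    using True assms by (auto simp: partitions_ge_def partitions_def)
next
  case False
  then show ?thesis using set_mset_partitions_ge by fastforce
qed

text \<open>Deleting one \<open>k\<close> maps the partitions containing \<open>k\<close>
  bijectively onto those of \<open>m - k\<close>. With \<open>f\<close> constant, a multiplicity or
  \<open>mset_moebius\<close>, this yields every recurrence below.\<close>

lemma sum_partitions_ge_split:
  fixes f :: "nat multiset \<Rightarrow> 'a::comm_monoid_add"
  assumes "1 \<le> k" "r \<le> k"
  shows "sum f (partitions_ge r m) = sum f {P \<in> partitions_ge r m. k \<notin># P}
    + (if k \<le> m then \<Sum>P\<in>partitions_ge r (m - k). f (add_mset k P) else 0)"
proof -
  have "sum f (partitions_ge r m)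
    = sum f {P \<in> partitions_ge r m. k \<notin># P} + sum f {P \<in> partitions_ge r m. k \<in># P}"
    by (subst sum.union_disjoint[symmetric]) (auto intro: sum.cong)
  then show ?thesis
    unfolding partitions_ge_containing[OF assms]
    by (auto simp: sum.reindex inj_on_def)
qed

section \<open>Moebius weights of partitions and the case \<open>r = 1\<close>\<close>

definition mset_moebius :: "nat multiset \<Rightarrow> int" where
  "mset_moebius P = (\<Sum>x\<in>#P. moebius x)"

lemma sum_mset_image_eq_sum_count:
  fixes f :: "'b \<Rightarrow> 'a::comm_semiring_1"
  assumes "finite A" "set_mset P \<subseteq> A"
  shows "(\<Sum>x\<in>#P. f x) = (\<Sum>k\<in>A. of_nat (count P k) * f k)"
  using assms(2)
proof (induction P)
  case (add x P)
  have "(\<Sum>k\<in>A. of_nat (count (add_mset x P) k) * f k)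
      = (\<Sum>k\<in>A. of_nat (count P k) * f k + (if k = x then f x else 0))"
    by (intro sum.cong) (auto simp: algebra_simps)
  then show ?case using add assms(1) by (simp add: sum.distrib add.commute)
qed simp

lemma sum_num_occurrences_moebius:
  "(\<Sum>k = r..m. int (num_occurrences r m k) * moebius k)
    = (\<Sum>P\<in>partitions_ge r m. mset_moebius P)"
proof -
  have "(\<Sum>P\<in>partitions_ge r m. mset_moebius P)
      = (\<Sum>P\<in>partitions_ge r m. \<Sum>k = r..m. int (count P k) * moebius k)"
    unfolding mset_moebius_def
    by (intro sum.cong sum_mset_image_eq_sum_count set_mset_partitions_ge) auto
  also have "\<dots> = (\<Sum>k = r..m. \<Sum>P\<in>partitions_ge r m. int (count P k) * moebius k)"
    by (rule sum.swap)
  finally show ?thesis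
    by (simp add: num_occurrences_def partitions_ge_def sum_distrib_right)
qed

text \<open>At least \<open>i\<close> copies of \<open>k\<close> occur in as many partitions of
  \<open>m\<close> as there are partitions of \<open>m - i * k\<close>; here \<open>d\<close> stands
  for \<open>i * k\<close>. The induction removes one copy, so \<open>d = k\<close> accounts for
  that copy and the other multiples are shifted by \<open>k\<close>.\<close>

lemma num_occurrences_1:
  assumes "1 \<le> k"
  shows "num_occurrences 1 m k = (\<Sum>d | d \<in> {1..m} \<and> k dvd d. card (partitions (m - d)))"
proof (induction m rule: less_induct)
  case (less m)
  have occ: "num_occurrences 1 m k = (\<Sum>P\<in>partitions_ge 1 m. count P k)" for m
    by (simp add: num_occurrences_def flip: partitions_ge_def)
  show ?case
  proof (cases "k \<le> m")
    case True
    have set_eq: "{d \<in> {1..m}. k dvd d} = insert k ((+) k ` {d \<in> {1..m - k}. k dvd d})"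
    proof -
      have "d \<in> insert k ((+) k ` {d \<in> {1..m - k}. k dvd d})" if "d \<in> {1..m}" "k dvd d" for d
      proof (cases "d = k")
        case False
        then have "k < d" using that by (auto dest: dvd_imp_le)
        then show ?thesis using that
          by (intro insertI2 image_eqI[of _ _ "d - k"]) auto
      qed simp
      then show ?thesis using True assms by auto
    qed
    have "num_occurrences 1 m k = card (partitions (m - k)) + num_occurrences 1 (m - k) k"
      using sum_partitions_ge_split[of k 1 "\<lambda>P. count P k" m] assms True
      unfolding occ by (simp add: sum.distrib not_in_iff sum_Suc)
    also have "\<dots> = card (partitions (m - k))
        + (\<Sum>d | d \<in> {1..m - k} \<and> k dvd d. card (partitions (m - k - d)))"
      using less[of "m - k"] True assms by simp
    finally show ?thesis
      unfolding set_eq by (simp add: sum.reindex diff_diff_left image_iff)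
  next
    case False
    then have "count P k = 0" if "P \<in> partitions_ge 1 m" for P
      using set_mset_partitions_ge[OF that] by (auto simp: count_eq_zero_iff)
    moreover have "{d \<in> {1..m}. k dvd d} = {}" using False by (auto dest: dvd_imp_le)
    ultimately show ?thesis unfolding occ by (simp only: sum.neutral_const sum.empty) simp
  qed
qed

text \<open>After interchanging the sums over \<open>k\<close> and its multiples \<open>d\<close>,
  the inner sum is a divisor sum of \<open>moebius\<close>, so only \<open>d = 1\<close>
  survives.\<close>

lemma sum_mset_moebius_partitions:
  "(\<Sum>P\<in>partitions m. mset_moebius P) = (if m = 0 then 0 else int (card (partitions (m - 1))))"
proof -
  have "(\<Sum>P\<in>partitions m. mset_moebius P)
      = (\<Sum>k = 1..m. int (num_occurrences 1 m k) * moebius k)"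
    using sum_num_occurrences_moebius[of 1 m] by simp
  also have "\<dots> = (\<Sum>k = 1..m. \<Sum>d | d \<in> {1..m} \<and> k dvd d.
      int (card (partitions (m - d))) * moebius k)"
    by (intro sum.cong refl) (simp only: num_occurrences_1 atLeastAtMost_iff of_nat_sum sum_distrib_right)
  also have "\<dots> = (\<Sum>d = 1..m. \<Sum>k | k \<in> {1..m} \<and> k dvd d.
      int (card (partitions (m - d))) * moebius k)"
    by (rule sum.swap_restrict) auto
  also have "\<dots> = (\<Sum>d = 1..m. int (card (partitions (m - d))) * (if d = 1 then 1 else 0))"
  proof (intro sum.cong refl)
    fix d assume d: "d \<in> {1..m}"
    have "{k \<in> {1..m}. k dvd d} = {k. k dvd d}"
      using d by (auto dest: dvd_imp_le intro: Nat.gr0I simp: Suc_le_eq)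
    then show "(\<Sum>k | k \<in> {1..m} \<and> k dvd d. int (card (partitions (m - d))) * moebius k)
        = int (card (partitions (m - d))) * (if d = 1 then 1 else 0)"
      using d sum_moebius_divisors[of d] by (simp flip: sum_distrib_left)
  qed
  also have "\<dots> = (if m = 0 then 0 else int (card (partitions (m - 1))))"
    by (simp add: if_distrib sum.delta cong: if_cong)
  finally show ?thesis .
qed

section \<open>Generating functions and their recurrences in \<open>r\<close>\<close>

definition fps_num_ge :: "nat \<Rightarrow> int fps" where
  "fps_num_ge r = Abs_fps (\<lambda>m. int (card (partitions_ge r m)))"

text \<open>Indexed by the partitioned number: the left-hand side for \<open>n\<close> is the
  coefficient at \<open>n + r\<close>, whence the factor \<open>X^r\<close> in
  \<open>F r = X^r A r N 1\<close>.\<close>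

definition fps_moebius_ge :: "nat \<Rightarrow> int fps" where
  "fps_moebius_ge r = Abs_fps (\<lambda>m. \<Sum>P\<in>partitions_ge r m. mset_moebius P)"

lemma fps_num_ge_Suc:
  assumes "r \<ge> 1"
  shows "fps_num_ge (Suc r) = (1 - fps_X ^ r) * fps_num_ge r"
  using sum_partitions_ge_split[of r r "\<lambda>_. 1::int"] assms
  by (intro fps_ext)
    (simp add: fps_num_ge_def partitions_ge_Suc left_diff_distrib fps_X_power_mult_nth)

text \<open>Deleting one \<open>r\<close> lowers the weight by \<open>moebius r\<close>; summed over
  the partitions containing \<open>r\<close>, this produces the extra term with
  \<open>fps_num_ge r\<close>.\<close>

lemma fps_moebius_ge_Suc:
  assumes "r \<ge> 1"
  shows "fps_moebius_ge (Suc r) = (1 - fps_X ^ r) * fps_moebius_ge r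
    - fps_const (moebius r) * fps_X ^ r * fps_num_ge r"
proof (intro fps_ext)
  fix m
  show "fps_moebius_ge (Suc r) $ m = ((1 - fps_X ^ r) * fps_moebius_ge r
    - fps_const (moebius r) * fps_X ^ r * fps_num_ge r) $ m"
    using sum_partitions_ge_split[of r r mset_moebius m] assms
    by (simp add: fps_num_ge_def fps_moebius_ge_def partitions_ge_Suc left_diff_distrib
      fps_X_power_mult_nth mult.assoc sum.distrib mset_moebius_def)
qed

lemma fps_moebius_ge_1: "fps_moebius_ge 1 = fps_X * fps_num_ge 1"
  by (intro fps_ext)
    (simp add: fps_moebius_ge_def fps_num_ge_def sum_mset_moebius_partitions)

text \<open>The only partition of \<open>r\<close> into parts at least \<open>r\<close> is
  \<open>r\<close> itself.\<close>

lemma fps_moebius_ge_nth_self: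
  assumes "r \<ge> 1"
  shows "fps_moebius_ge r $ r = moebius r"
  using sum_partitions_ge_split[of r r mset_moebius r] assms
    partitions_ge_empty[of r "Suc r"]
  by (simp add: fps_moebius_ge_def mset_moebius_def flip: partitions_ge_Suc)

theorem theorem1p3:
  fixes a b :: "nat \<Rightarrow> nat \<Rightarrow> int"
  assumes a_init: "\<And>j. a 1 j = (if j = 0 then 1 else 0)"
    and b_init: "\<And>j. b 1 j = (if j = 0 then 1 else 0)"
    and a_rec: "\<And>r j. r \<ge> 1 \<Longrightarrow>
      a (r + 1) j = a r (j + 1) - moebius r * b r (j + 1)
        - (if j + 1 < r then 0 else a r (j + 1 - r))"
    and b_rec: "\<And>r j. r \<ge> 1 \<Longrightarrow>
      b (r + 1) j = b r j - (if j < r then 0 else b r (j - r))"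
  shows "\<forall>n r. r \<ge> 1 \<longrightarrow>
    (\<Sum>k = r..n + r. int (num_occurrences r (n + r) k) * moebius k)
      = Sum_any (\<lambda>j. a r j * int (num_partitions (int n - int j)))"
proof (intro allI impI)
  fix n r :: nat
  assume r: "r \<ge> 1"
  define A B where "A = (\<lambda>r. Abs_fps (a r))" and "B = (\<lambda>r. Abs_fps (b r))"
  let ?P = "fps_num_ge 1"
  have P0: "?P $ 0 = 1" by (simp add: fps_num_ge_def)
  have init: "A 1 = 1" "B 1 = 1"
    by (auto simp: A_def B_def fps_eq_iff a_init[simplified] b_init[simplified])
  have B_Suc: "B (Suc r) = (1 - fps_X ^ r) * B r" if "r \<ge> 1" for r
    using b_rec[OF that]
    by (intro fps_ext) (simp add: B_def left_diff_distrib fps_X_power_mult_nth)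
  have b0: "b r 0 = 1" if "r \<ge> 1" for r
    using that
  proof (induction r rule: dec_induct)
    case base
    then show ?case by (simp add: b_init[simplified])
  next
    case (step r)
    then show ?case using b_rec[of r 0] by simp
  qed
  have main: "fps_num_ge r = B r * ?P \<and> fps_moebius_ge r = fps_X ^ r * (A r * ?P)"
    using r
  proof (induction r rule: dec_induct)
    case base
    then show ?case using fps_moebius_ge_1 by (simp add: init[simplified])
  next
    case (step r)
    then have N: "fps_num_ge r = B r * ?P" and F: "fps_moebius_ge r = fps_X ^ r * (A r * ?P)"
      by auto
    \<comment> \<open>Compare the coefficients at \<open>r\<close> in \<open>F\<close>; on the right
      only \<open>a r 0 * ?P $ 0\<close> remains.\<close>
    have "a r 0 = moebius r"
      using fps_moebius_ge_nth_self[OF step(1)] P0 unfolding F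
      by (simp add: fps_X_power_mult_nth A_def)
    \<comment> \<open>Positive coefficients are the recurrence for \<open>a\<close>. The constant
      one requires \<open>a r 0 = moebius r * b r 0\<close>, which holds as
      \<open>b r 0 = 1\<close>.\<close>
    then have A_Suc: "fps_X * A (Suc r) = (1 - fps_X ^ r) * A r - fps_const (moebius r) * B r"
      using a_rec[of r] b0[of r] step(1)
      by (intro fps_ext)
        (auto simp: A_def B_def left_diff_distrib fps_X_power_mult_nth not_less)
    have "fps_moebius_ge (Suc r)
        = fps_X ^ r * ((1 - fps_X ^ r) * A r - fps_const (moebius r) * B r) * ?P"
      unfolding fps_moebius_ge_Suc[OF step(1)] N F by (simp add: algebra_simps)
    also have "\<dots> = fps_X ^ Suc r * (A (Suc r) * ?P)"
      unfolding A_Suc[symmetric] by (simp add: algebra_simps)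
    finally show ?case
      using fps_num_ge_Suc[OF step(1)] N B_Suc[OF step(1)] by (simp add: mult.assoc)
  qed
  have "(\<Sum>k = r..n + r. int (num_occurrences r (n + r) k) * moebius k) = (A r * ?P) $ n"
    using arg_cong[OF conjunct2[OF main], of "\<lambda>f. f $ (n + r)"]
    by (simp add: sum_num_occurrences_moebius fps_X_power_mult_nth fps_moebius_ge_def)
  also have "\<dots> = (\<Sum>j\<in>{0..n}. a r j * int (num_partitions (int n - int j)))"
    unfolding fps_mult_nth
    by (intro sum.cong) (auto simp: A_def fps_num_ge_def num_partitions_def nat_diff_distrib)
  \<comment> \<open>For \<open>j > n\<close> the argument of \<open>num_partitions\<close> is
    negative, so the terms vanish and the support is finite.\<close>
  also have "\<dots> = Sum_any (\<lambda>j. a r j * int (num_partitions (int n - int j)))"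
    by (intro Sum_any.expand_superset[symmetric]) (auto simp: num_partitions_def)
  finally show "(\<Sum>k = r..n + r. int (num_occurrences r (n + r) k) * moebius k)
      = Sum_any (\<lambda>j. a r j * int (num_partitions (int n - int j)))" .
qed

end
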